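(* Let $p>3$ be a prime. Then $$\sum_{n=0}^{p-1}\frac{Q_n}{(-8)^n}\equiv1\pmod{p^2}\qquad\text{and}\qquad\sum_{n=0}^{p-1}\frac{Q_n}{(-9)^n}\equiv\Big(\frac p3\Big)\pmod{p^2}.$$
   Context: For $n\ge0$, $f_n=\sum_{k=0}^n\binom{n}{k}^3$ (Franel numbers) and $Q_n=\sum_{k=0}^n\binom{n}{k}(-8)^{n-k}f_k$. $\big(\frac p3\big)$ is the Legendre symbol. Congruences between rationals with denominators prime to $p$ are taken in the ring of such rationals. *)

theory Defs
  imports "HOL-Number_Theory.Number_Theory"
begin

definition franel :: "nat \<Rightarrow> int" where
  "franel n = (\<Sum>k\<le>n. int (n choose k) ^ 3)"

definition Q :: "nat \<Rightarrow> int" where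
  "Q n = (\<Sum>k\<le>n. int (n choose k) * (-8) ^ (n - k) * franel k)"

(* quotient_of yields the reduced fraction with positive denominator. *)
definition local_ring :: "nat \<Rightarrow> rat set" where
  "local_ring p = {x. coprime (snd (quotient_of x)) (int p)}"

(* Congruence modulo the ideal generated by m in the ring of rationals whose
   denominator is prime to p. The library's cong is of no use here: instantiated
   at the field rat, it would not be taken in this subring. *)
definition local_cong :: "nat \<Rightarrow> rat \<Rightarrow> rat \<Rightarrow> rat \<Rightarrow> bool" where
  "local_cong p m x y \<longleftrightarrow>
     x \<in> local_ring p \<and> y \<in> local_ring p \<and> (\<exists>z\<in>local_ring p. x - y = m * z)"

end

(* Write c = -8 or c = -9. Then Q is the binomial transform of an Apery-like sequence a with
   parameter c: a = f (Franel) for c = -8, and a = g, where g n = sum_k (n choose k)^2 (2k choose k)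
   is itself the binomial transform of f, for c = -9. Summing over n first,
     sum_{n<p} Q n c^(p-1-n) = a(p-1) + sum_{0<j<p} (p choose j) c^j a(p-1-j).
   Both sequences satisfy a three-term recurrence that is invariant modulo p under n -> p-1-n, so
   8^j f(p-1-j) is (-1)^j f(p-1) f(j) and 9^j g(p-1-j) is g(p-1) g(j) modulo p. As p divides
   (p choose j), the last sum becomes, modulo p^2, a multiple of
   sum_{0<j<p} (p choose j) f(j) or sum_{0<j<p} (p choose j) (-1)^j g(j); by the binomial transforms
   between f and g both are equal to g(p) - f(p) - 1, and f(p) = 2, g(p) = 3 modulo p^2.
   It remains to find a(p-1) modulo p^2. Since (p-1 choose k) is (-1)^k modulo p, its squares and
   cubes can be linearized modulo p^2: f(p-1) becomes 3 * 2^(p-1) - 2, which is 8^(p-1), and g(p-1)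
   becomes a combination of a central trinomial coefficient and the sum of the (2k choose k),
   both evaluated with cube roots of unity. *)
theory Submission
  imports Defs "HOL-Computational_Algebra.Polynomial"
begin

section \<open>Apery-like recurrences\<close>

text \<open>These numbers 1, 3, 15, 93, ... are the sums of the squares of all trinomial
  coefficients n!/(i! j! k!) with i + j + k = n.\<close>

definition franel_g :: "nat \<Rightarrow> int" where
  "franel_g n = (\<Sum>k\<le>n. int (n choose k) ^ 2 * int (2 * k choose k))"

text \<open>Creative telescoping: once a certificate \<open>G\<close> is known, a recurrence for the
  sums reduces to an identity between summands. The vanishing of \<open>F\<close> above the diagonal
  lets all three sums run over the same range.\<close>

lemma telescope_recurrence:
  fixes F :: "nat \<Rightarrow> nat \<Rightarrow> 'a::comm_ring_1"
  assumes "\<And>k. k \<le> n + 2 \<Longrightarrow> a * F (n + 2) k - b * F (n + 1) k - c * F n k = G (Suc k) - G k"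
    and "G 0 = 0" "G (n + 3) = 0"
    and zero: "\<And>m k. k > m \<Longrightarrow> F m k = 0"
  shows "a * (\<Sum>k\<le>n + 2. F (n + 2) k) = b * (\<Sum>k\<le>n + 1. F (n + 1) k) + c * (\<Sum>k\<le>n. F n k)"
proof -
  have ext: "(\<Sum>k\<le>m. F m k) = (\<Sum>k\<le>n + 2. F m k)" if "m \<le> n + 2" for m
    by (rule sum.mono_neutral_left) (use that zero in auto)
  have "a * (\<Sum>k\<le>n + 2. F (n + 2) k) - b * (\<Sum>k\<le>n + 2. F (n + 1) k) - c * (\<Sum>k\<le>n + 2. F n k)
      = (\<Sum>k\<le>n + 2. a * F (n + 2) k - b * F (n + 1) k - c * F n k)"
    by (simp only: sum_distrib_left sum_subtractf)
  also have "\<dots> = (\<Sum>k\<le>n + 2. G (Suc k) - G k)"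
    using assms(1) by (intro sum.cong) auto
  also have "\<dots> = G (Suc (n + 2)) - G 0"
    using sum_lessThan_telescope[of G "Suc (n + 2)"] by (simp only: lessThan_Suc_atMost)
  also have "\<dots> = 0"
    using assms(2,3) by (simp add: numeral_3_eq_3)
  finally have "a * (\<Sum>k\<le>n + 2. F (n + 2) k)
      = b * (\<Sum>k\<le>n + 2. F (n + 1) k) + c * (\<Sum>k\<le>n + 2. F n k)"
    by (simp only: diff_diff_eq right_minus_eq)
  then show ?thesis by (simp only: ext[of n, OF le_add1] ext[of "n + 1", OF add_le_mono[OF le_refl one_le_numeral]])
qed

text \<open>With a common scale \<open>s\<close>, all binomial coefficients occurring in a telescoping identity are
  polynomials in \<open>n\<close> and \<open>k\<close>, also at the boundary; this turns the identity into a polynomial one.\<close>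

lemma choose_parametrization:
  fixes n k :: nat
  assumes "k \<le> n + 2"
  obtains s :: rat where
    "(if k = 0 then 0 else of_nat (n + 1 choose (k - 1))) = of_nat k * s"
    "of_nat (n + 1 choose k) = (of_nat n + 2 - of_nat k) * s"
    "of_nat (n + 2 choose k) = (of_nat n + 2) * s"
    "(of_nat n + 1) * of_nat (n choose k) = (of_nat n + 1 - of_nat k) * (of_nat n + 2 - of_nat k) * s"
proof -
  have last: "(of_nat n + 1) * of_nat (n choose k) = (of_nat n + 1 - of_nat k) * (of_nat (n + 1 choose k) :: rat)"
  proof (cases "k \<le> n + 1")
    case True
    have "(n + 1 - k) * (n + 1 choose k) = (n + 1) * (n choose k)"
      using binomial_absorb_comp[of "n + 1" k] by simp
    then have "rat_of_nat (n + 1 - k) * rat_of_nat (n + 1 choose k) = rat_of_nat (n + 1) * rat_of_nat (n choose k)"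
      by (simp only: of_nat_mult [symmetric])
    with True show ?thesis by (simp add: of_nat_diff add_ac)
  next
    case False
    then show ?thesis by (simp add: binomial_eq_0 del: binomial_Suc_Suc)
  qed
  show thesis
  proof (cases k)
    case 0
    \<comment> \<open>The first equation forces \<open>s\<close> to be
      \<open>(n + 1 choose (k - 1)) / k\<close>. At \<open>k = 0\<close> it reads 0 = 0, and the
      third equation determines \<open>s\<close> instead.\<close>
    show ?thesis
      by (rule that[of "1 / (of_nat n + 2)"]) (use 0 last in \<open>auto simp: field_simps\<close>)
  next
    case (Suc i)
    have i: "i \<le> n + 1" using assms Suc by simp
    define u where "u = rat_of_nat (n + 1 choose i)"
    define v where "v = rat_of_nat (n + 1 choose Suc i)"
    have "(Suc i) * (n + 1 choose Suc i) = (n + 1 - i) * (n + 1 choose i)"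
      using binomial_absorption[of i "n + 1"] binomial_absorb_comp[of "n + 1" i] by simp
    then have "rat_of_nat (Suc i) * rat_of_nat (n + 1 choose Suc i) = rat_of_nat (n + 1 - i) * rat_of_nat (n + 1 choose i)"
      by (simp only: of_nat_mult [symmetric])
    then have uv: "(of_nat i + 1) * v = (of_nat n + 1 - of_nat i) * u"
      using i unfolding u_def v_def by (simp add: of_nat_diff add_ac del: binomial_Suc_Suc)
    have v: "v = (of_nat n + 1 - of_nat i) * (u / (of_nat i + 1))"
      using uv by (simp add: field_simps)
    have pas: "rat_of_nat (n + 2 choose Suc i) = u + v" unfolding u_def v_def by simp
    have 2: "rat_of_nat (n + 1 choose k) = (of_nat n + 2 - of_nat k) * (u / (of_nat i + 1))"
      using v Suc unfolding v_def by simp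
    show ?thesis
    proof (rule that[of "u / (of_nat i + 1)"])
      show "(if k = 0 then 0 else of_nat (n + 1 choose (k - 1))) = of_nat k * (u / (of_nat i + 1))"
        using Suc by (simp add: u_def add_ac)
      show "of_nat (n + 2 choose k) = (of_nat n + 2) * (u / (of_nat i + 1))"
        unfolding Suc pas v by (simp add: field_simps)
      show "(of_nat n + 1) * of_nat (n choose k) = (of_nat n + 1 - of_nat k) * (of_nat n + 2 - of_nat k) * (u / (of_nat i + 1))"
        unfolding last unfolding 2 by simp
    qed (rule 2)
  qed
qed

text \<open>\<open>P\<close> is the Zeilberger certificate, rescaled so that no denominators occur.\<close>

lemma franel_recurrence:
  "(int n + 2)^2 * franel (n + 2)
    = (7 * (int n + 1) * (int n + 2) + 2) * franel (n + 1) + 8 * (int n + 1)^2 * franel n"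
proof -
  define N where "N = rat_of_nat n + 1"
  define P where "P k = 4 * k^3 - (18 * N + 12) * k^2 + (27 * N^2 + 39 * N + 12) * k
      - 14 * N^3 - 32 * N^2 - 22 * N - 4" for k
  \<comment> \<open>Truncated subtraction would make \<open>n + 1 choose (k - 1)\<close> equal to 1
    at \<open>k = 0\<close>; the explicit zero makes the telescoping sum start at 0.\<close>
  define G where "G k = N^2 * P (of_nat k) * (if k = 0 then 0 else of_nat (n + 1 choose (k - 1)))^3" for k
  \<comment> \<open>Only \<open>N\<close> times \<open>n choose k\<close> is a polynomial multiple
    of the scale \<open>s\<close>, so its cube costs a factor \<open>N^3\<close>, cancelled at the
    end.\<close>
  have "N^3 * (N + 1)^2 * (\<Sum>k\<le>n + 2. rat_of_nat (n + 2 choose k)^3)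
    = N^3 * (7 * N * (N + 1) + 2) * (\<Sum>k\<le>n + 1. rat_of_nat (n + 1 choose k)^3)
      + N^3 * (8 * N^2) * (\<Sum>k\<le>n. rat_of_nat (n choose k)^3)"
  proof (rule telescope_recurrence)
    fix k assume "k \<le> n + 2"
    then obtain s :: rat where s: "(if k = 0 then 0 else of_nat (n + 1 choose (k - 1))) = of_nat k * s"
    "of_nat (n + 1 choose k) = (of_nat n + 2 - of_nat k) * s"
    "of_nat (n + 2 choose k) = (of_nat n + 2) * s"
    "(of_nat n + 1) * of_nat (n choose k) = (of_nat n + 1 - of_nat k) * (of_nat n + 2 - of_nat k) * s"
      by (rule choose_parametrization)
    define K where "K = rat_of_nat k"
    have v: "of_nat (n + 1 choose k) = (N + 1 - K) * s" using s(2) by (simp add: N_def K_def)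
    have w: "of_nat (n + 2 choose k) = (N + 1) * s" using s(3) by (simp add: N_def)
    have nc: "N * of_nat (n choose k) = (N - K) * (N + 1 - K) * s"
      using s(4) by (simp add: N_def K_def)
    have "N^3 * (8 * N^2) * of_nat (n choose k)^3 = 8 * N^2 * (N * of_nat (n choose k))^3"
      by (simp add: power_mult_distrib)
    also have "\<dots> = 8 * N^2 * ((N - K) * (N + 1 - K) * s)^3" by (simp only: nc)
    finally have 1: "N^3 * (8 * N^2) * of_nat (n choose k)^3 = 8 * N^2 * ((N - K) * (N + 1 - K) * s)^3" .
    have G1: "G (Suc k) = N^2 * P (K + 1) * ((N + 1 - K) * s)^3"
      using v by (simp add: G_def K_def add_ac)
    have G0: "G k = N^2 * P K * (K * s)^3"
      unfolding G_def s(1) by (simp add: K_def)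
    show "N^3 * (N + 1)^2 * of_nat (n + 2 choose k)^3 - N^3 * (7 * N * (N + 1) + 2) * of_nat (n + 1 choose k)^3
      - N^3 * (8 * N^2) * of_nat (n choose k)^3 = G (Suc k) - G k"
      unfolding 1 G0 G1 w v P_def by (simp add: algebra_simps power2_eq_square power3_eq_cube)
  qed (simp_all add: G_def binomial_eq_0)
  then have "N^3 * ((N + 1)^2 * of_int (franel (n + 2)))
    = N^3 * ((7 * N * (N + 1) + 2) * of_int (franel (n + 1)) + 8 * N^2 * of_int (franel n))"
    by (simp add: franel_def algebra_simps del: sum.atMost_Suc binomial_Suc_Suc)
  moreover have "N^3 \<noteq> 0" unfolding N_def by (metis of_nat_Suc add.commute of_nat_eq_0_iff nat.simps(3) power_eq_0_iff)
  ultimately have "(N + 1)^2 * of_int (franel (n + 2))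
    = (7 * N * (N + 1) + 2) * of_int (franel (n + 1)) + 8 * N^2 * of_int (franel n)"
    by (metis mult_left_cancel)
  moreover have "N = of_int (int n + 1)" "N + 1 = of_int (int n + 2)" by (simp_all add: N_def)
  ultimately have "rat_of_int ((int n + 2)^2 * franel (n + 2))
    = of_int ((7 * (int n + 1) * (int n + 2) + 2) * franel (n + 1) + 8 * (int n + 1)^2 * franel n)"
    by (simp only: of_int_mult of_int_add of_int_power of_int_numeral)
  then show ?thesis by (simp only: of_int_eq_iff)
qed

lemma central_binomial_Suc: "(k + 1) * (2 * (k + 1) choose (k + 1)) = 2 * (2 * k + 1) * (2 * k choose k)"
proof -
  have "(k + 1) * ((k + 1) * (2 * (k + 1) choose (k + 1))) = (k + 1) * (2 * (2 * k + 1) * (2 * k choose k))"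
    using binomial_absorption[of k "2*k+2"] binomial_absorb_comp[of "2*k+1" k]
    by (simp add: algebra_simps)
  then show ?thesis by (simp only: mult_cancel1) simp
qed

text \<open>Creative telescoping with another certificate. Here the coefficient \<open>N^2\<close>
  of the last sum already clears the denominators of the squared binomial coefficient.\<close>

lemma franel_g_recurrence:
  "(int n + 2)^2 * franel_g (n + 2)
    = (10 * (int n + 1) * (int n + 2) + 3) * franel_g (n + 1) + (-9) * (int n + 1)^2 * franel_g n"
proof -
  define N where "N = rat_of_nat n + 1"
  define P where "P k = (2 * k - 1) * (6 * k - 8 * (N + 1))" for k
  define C where "C k = rat_of_nat (2 * k choose k)" for k
  define G where "G k = P (of_nat k) * (if k = 0 then 0 else of_nat (n + 1 choose (k - 1)))^2 * C (k - 1)" for k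
  have N0: "N \<noteq> 0" unfolding N_def by (metis of_nat_Suc add.commute of_nat_eq_0_iff nat.simps(3))
  have "(N + 1)^2 * (\<Sum>k\<le>n + 2. rat_of_nat (n + 2 choose k)^2 * C k)
    = (10 * N * (N + 1) + 3) * (\<Sum>k\<le>n + 1. rat_of_nat (n + 1 choose k)^2 * C k)
      + (-9) * N^2 * (\<Sum>k\<le>n. rat_of_nat (n choose k)^2 * C k)"
  proof (rule telescope_recurrence)
    fix k assume "k \<le> n + 2"
    then obtain s :: rat where s: "(if k = 0 then 0 else of_nat (n + 1 choose (k - 1))) = of_nat k * s"
    "of_nat (n + 1 choose k) = (of_nat n + 2 - of_nat k) * s"
    "of_nat (n + 2 choose k) = (of_nat n + 2) * s"
    "(of_nat n + 1) * of_nat (n choose k) = (of_nat n + 1 - of_nat k) * (of_nat n + 2 - of_nat k) * s"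
      by (rule choose_parametrization)
    define K where "K = rat_of_nat k"
    have v: "of_nat (n + 1 choose k) = (N + 1 - K) * s" using s(2) by (simp add: N_def K_def)
    have w: "of_nat (n + 2 choose k) = (N + 1) * s" using s(3) by (simp add: N_def)
    have nc: "N * of_nat (n choose k) = (N - K) * (N + 1 - K) * s"
      using s(4) by (simp add: N_def K_def)
    have "(-9) * N^2 * (of_nat (n choose k)^2 * C k) = (-9) * (N * of_nat (n choose k))^2 * C k"
      by (simp add: power_mult_distrib)
    also have "\<dots> = (-9) * ((N - K) * (N + 1 - K) * s)^2 * C k" by (simp only: nc)
    finally have 1: "(-9) * N^2 * (of_nat (n choose k)^2 * C k) = (-9) * ((N - K) * (N + 1 - K) * s)^2 * C k" .
    have G1: "G (Suc k) = P (K + 1) * ((N + 1 - K) * s)^2 * C k"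
      using v by (simp add: G_def K_def add_ac)
    have CC: "2 * (2 * K - 1) * C (k - 1) = K * C k" if "k > 0"
    proof -
      from that obtain i where i: "k = i + 1" by (metis Suc_eq_plus1 Suc_pred')
      have "rat_of_nat ((i + 1) * (2 * (i + 1) choose (i + 1))) = rat_of_nat (2 * (2 * i + 1) * (2 * i choose i))"
        by (simp only: central_binomial_Suc)
      then show ?thesis unfolding i K_def C_def by (simp add: algebra_simps del: binomial_Suc_Suc)
    qed
    \<comment> \<open>The factor \<open>2 * k - 1\<close> of \<open>P\<close> turns
      \<open>C (k - 1)\<close> into a multiple of \<open>C k\<close>, so that all terms share
      \<open>C k\<close>. Doubling matches the 2 in \<open>CC\<close>.\<close>
    have G0: "2 * G k = K^3 * s^2 * C k * (6 * K - 8 * (N + 1))"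
    proof (cases "k = 0")
      case True
      then show ?thesis by (simp add: G_def K_def)
    next
      case False
      have "2 * G k = (2 * (2 * K - 1) * C (k - 1)) * (6 * K - 8 * (N + 1)) * (K * s)^2"
        unfolding G_def s(1) by (simp add: K_def P_def)
      also have "\<dots> = (K * C k) * (6 * K - 8 * (N + 1)) * (K * s)^2" using CC False by simp
      finally show ?thesis by (simp add: power_mult_distrib power3_eq_cube power2_eq_square)
    qed
    have "2 * ((N + 1)^2 * (of_nat (n + 2 choose k)^2 * C k) - (10 * N * (N + 1) + 3) * (of_nat (n + 1 choose k)^2 * C k)
      - (-9) * N^2 * (of_nat (n choose k)^2 * C k)) = 2 * G (Suc k) - 2 * G k"
      unfolding 1 G0 G1 w v P_def by (simp add: algebra_simps power2_eq_square power3_eq_cube)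
    then show "(N + 1)^2 * (of_nat (n + 2 choose k)^2 * C k) - (10 * N * (N + 1) + 3) * (of_nat (n + 1 choose k)^2 * C k)
      - (-9) * N^2 * (of_nat (n choose k)^2 * C k) = G (Suc k) - G k" by simp
  qed (simp_all add: G_def binomial_eq_0)
  then have "(N + 1)^2 * of_int (franel_g (n + 2))
    = (10 * N * (N + 1) + 3) * of_int (franel_g (n + 1)) + (-9) * N^2 * of_int (franel_g n)"
    by (simp add: franel_g_def C_def del: sum.atMost_Suc binomial_Suc_Suc)
  moreover have "N = of_int (int n + 1)" "N + 1 = of_int (int n + 2)" by (simp_all add: N_def)
  ultimately have "rat_of_int ((int n + 2)^2 * franel_g (n + 2))
    = of_int ((10 * (int n + 1) * (int n + 2) + 3) * franel_g (n + 1) + (-9) * (int n + 1)^2 * franel_g n)"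
    by (simp only: of_int_mult of_int_add of_int_power of_int_numeral of_int_minus)
  then show ?thesis by (simp only: of_int_eq_iff)
qed

section \<open>Binomial transforms\<close>

text \<open>Trinomial revision, with the lower index complemented: after reversing the order of
  summation, sums over \<open>j\<close> become binomial or Vandermonde sums. For
  \<open>i > j\<close> both sides vanish.\<close>

lemma choose_choose_compl:
  assumes "j \<le> n" "i \<le> n"
  shows "(n choose j) * (j choose i) = (n choose i) * ((n - i) choose (n - j))"
proof (cases "i \<le> j")
  case True
  have "(n choose j) * (j choose i) = (n choose i) * ((n - i) choose (j - i))"
    using choose_mult[OF True assms(1)] .
  also have "(n - i) choose (j - i) = (n - i) choose (n - j)"
    using binomial_symmetric[of "j - i" "n - i"] True assms by simp
  finally show ?thesis .
qed (use assms in \<open>auto simp: binomial_eq_0\<close>)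

lemma sum_rev_atMost: "(\<Sum>k\<le>n. f (n - k)) = (\<Sum>k\<le>(n::nat). f k :: 'a::comm_monoid_add)"
  using sum.nat_diff_reindex[of f "Suc n"] by (simp add: lessThan_Suc_atMost)

lemma sum_choose_mult_choose:
  assumes "a \<le> M"
  shows "(\<Sum>m\<le>M. (a choose m) * (b choose m)) = (a + b) choose a"
proof -
  have "(\<Sum>m\<le>M. (a choose m) * (b choose m)) = (\<Sum>m\<le>a. (a choose m) * (b choose m))"
    by (rule sum.mono_neutral_right) (use assms in \<open>auto simp: binomial_eq_0\<close>)
  also have "\<dots> = (\<Sum>m\<le>a. (b choose m) * (a choose (a - m)))"
  proof (intro sum.cong refl)
    fix m assume "m \<in> {..a}"
    then have "a choose m = a choose (a - m)" by (intro binomial_symmetric) simp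
    then show "(a choose m) * (b choose m) = (b choose m) * (a choose (a - m))" by simp
  qed
  also have "\<dots> = (b + a) choose a" by (rule vandermonde)
  finally show ?thesis by (simp add: add.commute)
qed

definition binomial_transform :: "int \<Rightarrow> (nat \<Rightarrow> int) \<Rightarrow> nat \<Rightarrow> int" where
  "binomial_transform c a n = (\<Sum>k\<le>n. int (n choose k) * c ^ (n - k) * a k)"

lemma binomial_transform_0: "binomial_transform 0 a n = a n"
proof -
  have "binomial_transform 0 a n = (\<Sum>k\<in>{n}. int (n choose k) * 0 ^ (n - k) * a k)"
    unfolding binomial_transform_def by (rule sum.mono_neutral_right) auto
  then show ?thesis by simp
qed

text \<open>On exponential generating functions the transform is multiplication by exp(c x), so
  parameters add. Coefficientwise this is trinomial revision followed by the binomial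
  theorem.\<close>

lemma binomial_transform_binomial_transform:
  "binomial_transform c (binomial_transform d a) n = binomial_transform (c + d) a n"
proof -
  have inner: "(\<Sum>k\<le>n. int (n choose k) * int (k choose j) * c ^ (n - k) * d ^ (k - j))
      = int (n choose j) * (c + d) ^ (n - j)" if j: "j \<le> n" for j
  proof -
    have "(\<Sum>k\<le>n. int (n choose k) * int (k choose j) * c ^ (n - k) * d ^ (k - j))
      = (\<Sum>k\<le>n. int (n choose j) * (int ((n - j) choose (n - k)) * c ^ (n - k) * d ^ (n - (n - k) - j)))"
      by (intro sum.cong refl)
        (use j in \<open>simp add: choose_choose_compl flip: of_nat_mult\<close>)
    also have "\<dots> = (\<Sum>m\<le>n. int (n choose j) * (int ((n - j) choose m) * c ^ m * d ^ (n - m - j)))"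
      by (rule sum_rev_atMost)
    also have "\<dots> = (\<Sum>m\<le>n - j. int (n choose j) * (int ((n - j) choose m) * c ^ m * d ^ (n - m - j)))"
      by (rule sum.mono_neutral_right) (auto simp: binomial_eq_0)
    also have "\<dots> = int (n choose j) * (c + d) ^ (n - j)"
      unfolding binomial_ring sum_distrib_left by (intro sum.cong refl) (simp add: add.commute)
    finally show ?thesis .
  qed
  have "binomial_transform c (binomial_transform d a) n
      = (\<Sum>k\<le>n. \<Sum>j\<le>k. int (n choose k) * c ^ (n - k) * (int (k choose j) * d ^ (k - j) * a j))"
    by (simp add: binomial_transform_def sum_distrib_left)
  also have "\<dots> = (\<Sum>k\<le>n. \<Sum>j\<le>n. int (n choose k) * c ^ (n - k) * (int (k choose j) * d ^ (k - j) * a j))"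
    by (intro sum.cong refl sum.mono_neutral_left) (auto simp: binomial_eq_0)
  also have "\<dots> = (\<Sum>j\<le>n. \<Sum>k\<le>n. int (n choose k) * int (k choose j) * c ^ (n - k) * d ^ (k - j) * a j)"
    by (subst sum.swap) (simp add: mult_ac)
  also have "\<dots> = (\<Sum>j\<le>n. int (n choose j) * (c + d) ^ (n - j) * a j)"
    by (intro sum.cong refl) (simp add: inner flip: sum_distrib_right)
  finally show ?thesis by (simp add: binomial_transform_def)
qed

text \<open>Vandermonde expands \<open>2 * j choose n\<close> into a sum over \<open>i\<close>.
  Trinomial revision then moves \<open>j\<close> into the lower indices only, and Vandermonde in
  \<open>j\<close> yields the third factor \<open>n choose i\<close>.\<close>

lemma franel_eq_sum_square_mult_central:
  "franel n = (\<Sum>j\<le>n. int (n choose j) ^ 2 * int (2 * j choose n))"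
proof -
  have "(\<Sum>j\<le>n. (n choose j) ^ 2 * (2 * j choose n))
      = (\<Sum>j\<le>n. \<Sum>i\<le>n. ((n choose j) * (j choose i)) * ((n choose j) * (j choose (n - i))))"
  proof (intro sum.cong refl)
    fix j
    have "2 * j choose n = (\<Sum>i\<le>n. (j choose i) * (j choose (n - i)))"
      using vandermonde[of j j n] by (simp add: mult_2)
    then show "(n choose j) ^ 2 * (2 * j choose n)
        = (\<Sum>i\<le>n. ((n choose j) * (j choose i)) * ((n choose j) * (j choose (n - i))))"
      by (simp add: sum_distrib_left power2_eq_square mult_ac)
  qed
  also have "\<dots> = (\<Sum>j\<le>n. \<Sum>i\<le>n. (n choose i) ^ 2 * (((n - i) choose (n - j)) * (i choose (n - j))))"
  proof (intro sum.cong refl)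
    fix j i assume "j \<in> {..n}" "i \<in> {..n}"
    then have ji: "j \<le> n" "i \<le> n" by auto
    have "(n choose j) * (j choose (n - i)) = (n choose i) * (i choose (n - j))"
      using choose_choose_compl[of j n "n - i"] ji binomial_symmetric[of i n] by simp
    moreover have "(n choose j) * (j choose i) = (n choose i) * ((n - i) choose (n - j))"
      using choose_choose_compl ji by blast
    ultimately show "((n choose j) * (j choose i)) * ((n choose j) * (j choose (n - i)))
      = (n choose i) ^ 2 * (((n - i) choose (n - j)) * (i choose (n - j)))"
      by (simp only: power2_eq_square mult_ac)
  qed
  also have "\<dots> = (\<Sum>i\<le>n. (n choose i) ^ 2 * (\<Sum>j\<le>n. ((n - i) choose (n - j)) * (i choose (n - j))))"
    by (subst sum.swap) (simp add: sum_distrib_left)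
  also have "\<dots> = (\<Sum>i\<le>n. (n choose i) ^ 3)"
  proof (intro sum.cong refl)
    fix i assume "i \<in> {..n}"
    then have "(\<Sum>j\<le>n. ((n - i) choose (n - j)) * (i choose (n - j))) = n choose i"
      using sum_rev_atMost[of "\<lambda>m. ((n - i) choose m) * (i choose m)" n]
        sum_choose_mult_choose[of "n - i" n i] binomial_symmetric[of i n] by simp
    then show "(n choose i) ^ 2 * (\<Sum>j\<le>n. ((n - i) choose (n - j)) * (i choose (n - j))) = (n choose i) ^ 3"
      by (simp add: power2_eq_square power3_eq_cube)
  qed
  finally have "int (\<Sum>i\<le>n. (n choose i) ^ 3) = int (\<Sum>j\<le>n. (n choose j) ^ 2 * (2 * j choose n))"
    by (rule arg_cong[OF sym])
  then show ?thesis by (simp add: franel_def)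
qed

text \<open>Trinomial revision inside row \<open>2 * j\<close> isolates the central coefficient,
  which depends on \<open>j\<close> alone; this is the form needed to compare with
  \<open>franel_g\<close>.\<close>

lemma franel_eq_sum_central:
  "franel n = (\<Sum>j\<le>n. int ((n choose j) * (j choose (n - j)) * (2 * j choose j)))"
  unfolding franel_eq_sum_square_mult_central
proof (intro sum.cong refl)
  fix j assume "j \<in> {..n}"
  then have j: "j \<le> n" by simp
  have "(n choose j) * (2 * j choose n) = (j choose (n - j)) * (2 * j choose j)"
  proof (cases "n \<le> 2 * j")
    case True
    then show ?thesis using choose_mult[OF j True] by (simp add: mult_ac)
  qed (simp add: binomial_eq_0)
  then have "int ((n choose j) * ((n choose j) * (2 * j choose n)))
      = int ((n choose j) * ((j choose (n - j)) * (2 * j choose j)))"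
    by (simp only:)
  then show "int (n choose j) ^ 2 * int (2 * j choose n) = int ((n choose j) * (j choose (n - j)) * (2 * j choose j))"
    by (simp add: power2_eq_square mult_ac)
qed

text \<open>Comparing the coefficients of \<open>2 * j choose j\<close> leaves a sum over
  \<open>k\<close> that trinomial revision and Vandermonde evaluate to
  \<open>(n choose j) ^ 2\<close>.\<close>

lemma franel_g_eq_binomial_transform: "franel_g n = binomial_transform 1 franel n"
proof -
  have inner: "(\<Sum>k\<le>n. (n choose k) * (k choose j) * (j choose (k - j))) = (n choose j) ^ 2" if j: "j \<le> n" for j
  proof -
    have "(\<Sum>k\<le>n. (n choose k) * (k choose j) * (j choose (k - j)))
      = (\<Sum>k\<le>n. (n choose j) * (((n - j) choose (n - k)) * (j choose (n - j - (n - k)))))"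
      by (intro sum.cong refl) (use j in \<open>simp add: choose_choose_compl\<close>)
    also have "\<dots> = (\<Sum>m\<le>n. (n choose j) * (((n - j) choose m) * (j choose (n - j - m))))"
      by (rule sum_rev_atMost)
    also have "\<dots> = (\<Sum>m\<le>n - j. (n choose j) * (((n - j) choose m) * (j choose (n - j - m))))"
      by (rule sum.mono_neutral_right) (auto simp: binomial_eq_0)
    also have "\<dots> = (n choose j) * (n choose (n - j))"
      using vandermonde[of "n - j" j "n - j"] j by (simp flip: sum_distrib_left)
    also have "n choose (n - j) = n choose j" using binomial_symmetric[OF j] by simp
    finally show ?thesis by (simp add: power2_eq_square)
  qed
  have "binomial_transform 1 franel n
      = (\<Sum>k\<le>n. \<Sum>j\<le>k. int ((n choose k) * (k choose j) * (j choose (k - j))) * int (2 * j choose j))"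
    by (simp add: binomial_transform_def franel_eq_sum_central sum_distrib_left mult_ac)
  also have "\<dots> = (\<Sum>k\<le>n. \<Sum>j\<le>n. int ((n choose k) * (k choose j) * (j choose (k - j))) * int (2 * j choose j))"
    by (intro sum.cong refl sum.mono_neutral_left) (auto simp: binomial_eq_0)
  also have "\<dots> = (\<Sum>j\<le>n. int (\<Sum>k\<le>n. (n choose k) * (k choose j) * (j choose (k - j))) * int (2 * j choose j))"
    by (subst sum.swap) (simp add: sum_distrib_right)
  also have "\<dots> = franel_g n"
    unfolding franel_g_def by (intro sum.cong refl) (simp add: inner)
  finally show ?thesis by simp
qed

lemma Q_eq_binomial_transform_franel: "Q n = binomial_transform (-8) franel n"
  by (simp add: Q_def binomial_transform_def)

text \<open>Parameters add: \<open>-9 + 1 = -8\<close>. In the same way \<open>-1 + 1 = 0\<close>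
  gives the inversion formula below.\<close>

lemma Q_eq_binomial_transform_cgf: "Q n = binomial_transform (-9) franel_g n"
  using binomial_transform_binomial_transform[of "-9" 1 franel n]
  by (simp add: Q_eq_binomial_transform_franel franel_g_eq_binomial_transform[abs_def])

lemma franel_eq_binomial_transform: "franel n = binomial_transform (-1) franel_g n"
  using binomial_transform_binomial_transform[of "-1" 1 franel n]
  by (simp add: binomial_transform_0 franel_g_eq_binomial_transform[abs_def])

section \<open>Reflection and values modulo the square of a prime\<close>

text \<open>Modulo \<open>p\<close>, the sequence \<open>(- c)^j * a (p - 1 - j)\<close> satisfies the same recurrence as \<open>a\<close>.\<close>

lemma dvd_recurrence_reflection:
  fixes a :: "nat \<Rightarrow> int" and A B c :: int
  assumes p: "prime p"
    and rec: "\<And>n. (int n + 2)^2 * a (n + 2) = (A * (int n + 1) * (int n + 2) + B) * a (n + 1) + c * (int n + 1)^2 * a n"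
    and a0: "a 0 = 1" and a1: "a 1 = B"
    and "j < p"
  shows "int p dvd (- c) ^ j * a (p - 1 - j) - a (p - 1) * a j"
  using \<open>j < p\<close>
proof (induction j rule: less_induct)
  case (less j)
  define P where "P = int p"
  consider "j = 0" | "j = 1" | i where "j = i + 2"
    by (metis Suc_eq_plus1 add_2_eq_Suc' not0_implies_Suc One_nat_def)
  then show ?case
  proof cases
    case 1
    then show ?thesis using a0 by simp
  next
    case 2
    with less.prems have p2: "p = (p - 2) + 2" by simp
    have ints: "int (p - 2) + 2 = P" "int (p - 2) + 1 = P - 1" "p - 2 + 2 = p" "p - 2 + 1 = p - 1"
      using p2 by (auto simp: P_def)
    \<comment> \<open>Stepping from \<open>p - 2\<close> to \<open>p\<close>, the leading
      coefficient vanishes modulo \<open>p\<close>, which ties \<open>a (p - 2)\<close> to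
      \<open>a (p - 1)\<close>.\<close>
    have "P^2 * a p = (A * (P - 1) * P + B) * a (p - 1) + c * (P - 1)^2 * a (p - 2)"
      using rec[of "p - 2"] unfolding ints .
    then have "(- c) * a (p - 2) - a (p - 1) * B
        = P * (A * (P - 1) * a (p - 1) + c * (P - 2) * a (p - 2) - P * a p)"
      by (simp add: algebra_simps power2_eq_square)
    then show ?thesis using 2 a1 by (simp add: P_def numeral_2_eq_2)
  next
    case (3 i)
    define J where "J = int i"
    define t where "t = a (p - 1)"
    define q where "q = A * (J + 1) * (J + 2) + B"
    have pe: "p - 3 - i + 3 + i = p" using less.prems 3 by simp
    have ints: "int (p - 3 - i) + 2 = P - 1 - J" "int (p - 3 - i) + 1 = P - 2 - J"
      "p - 3 - i + 2 = p - 1 - i" "p - 3 - i + 1 = p - 1 - (i + 1)" "p - 3 - i = p - 1 - (i + 2)"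
      using pe by (auto simp: P_def J_def)
    define x0 x1 x2 where "x0 = a (p - 1 - (i + 2))" and "x1 = a (p - 1 - (i + 1))" and "x2 = a (p - 1 - i)"
    \<comment> \<open>The recurrence at \<open>p - 3 - i\<close> with \<open>P\<close> dropped from
      its coefficients. Apart from the place of \<open>c\<close>, it is the recurrence at
      \<open>i\<close> with the two outer squares exchanged, which is the reflection
      symmetry.\<close>
    define D where "D = (J + 1)^2 * x2 - q * x1 - c * (J + 2)^2 * x0"
    have "(P - 1 - J)^2 * x2 = (A * (P - 2 - J) * (P - 1 - J) + B) * x1 + c * (P - 2 - J)^2 * x0"
      unfolding x0_def x1_def x2_def using rec[of "p - 3 - i"] ints by metis
    then have "D = P * (A * (P - 2 * J - 3) * x1 + c * (P - 2 * J - 4) * x0 - (P - 2 * J - 2) * x2)"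
      unfolding D_def q_def by (simp add: algebra_simps power2_eq_square)
    then have D: "P dvd D" by simp
    have r: "(J + 2)^2 * a (i + 2) = q * a (i + 1) + c * (J + 1)^2 * a i"
      using rec[of i] unfolding J_def q_def .
    have h0: "P dvd (- c) ^ i * x2 - t * a i"
      using less.IH[of i] less.prems 3 by (simp add: P_def t_def x2_def)
    have h1: "P dvd (- c) ^ (i + 1) * x1 - t * a (i + 1)"
      using less.IH[of "i + 1"] less.prems 3 by (simp add: P_def t_def x1_def)
    have "(J + 2)^2 * ((- c) ^ (i + 2) * x0 - t * a (i + 2))
      = (- c) ^ (i + 1) * D + q * ((- c) ^ (i + 1) * x1 - t * a (i + 1))
        + c * (J + 1)^2 * ((- c) ^ i * x2 - t * a i)"
    proof -
      have "(- c) ^ (i + 2) = c^2 * (- c) ^ i" "(- c) ^ (i + 1) = - c * (- c) ^ i"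
        by (simp_all add: power_add power2_eq_square)
      then have "(- c) ^ (i + 1) * D + q * ((- c) ^ (i + 1) * x1 - t * a (i + 1))
          + c * (J + 1)^2 * ((- c) ^ i * x2 - t * a i)
        = (J + 2)^2 * ((- c) ^ (i + 2) * x0) - t * (q * a (i + 1) + c * (J + 1)^2 * a i)"
        by (simp add: D_def algebra_simps power2_eq_square del: power_Suc)
      also have "\<dots> = (J + 2)^2 * ((- c) ^ (i + 2) * x0) - t * ((J + 2)^2 * a (i + 2))"
        by (simp only: r)
      finally show ?thesis by (simp add: right_diff_distrib mult_ac)
    qed
    then have "P dvd (J + 2)^2 * ((- c) ^ (i + 2) * x0 - t * a (i + 2))"
      using D h0 h1 by (simp only: dvd_add dvd_mult)
    \<comment> \<open>\<open>J + 2\<close> is the index \<open>j\<close> itself, strictly between 0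
      and \<open>p\<close>, so its square can be cancelled modulo \<open>p\<close>.\<close>
    moreover have "\<not> P dvd (J + 2)^2"
    proof
      assume "P dvd (J + 2)^2"
      then have "P dvd J + 2"
        using p prime_dvd_power_int[of P "J + 2" 2] by (simp add: P_def)
      moreover have "J + 2 > 0" "J + 2 < P" using less.prems 3 by (auto simp: J_def P_def)
      ultimately show False using zdvd_not_zless by blast
    qed
    moreover have "prime P" using p by (simp add: P_def)
    ultimately have "P dvd (- c) ^ (i + 2) * x0 - t * a (i + 2)"
      using prime_dvd_mult_iff by blast
    then show ?thesis by (simp add: P_def 3 x0_def t_def)
  qed
qed

lemma franel_reflection:
  assumes "prime p" "j < p"
  shows "int p dvd (-8) ^ j * franel (p - 1 - j) - franel (p - 1) * franel j"
  using assms(1) _ _ _ assms(2)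
  by (rule dvd_recurrence_reflection[where A = 7 and B = 2])
    (use franel_recurrence in \<open>auto simp: franel_def\<close>)

lemma franel_g_reflection:
  assumes "prime p" "j < p"
  shows "int p dvd 9 ^ j * franel_g (p - 1 - j) - franel_g (p - 1) * franel_g j"
proof -
  have "int p dvd (- (- 9)) ^ j * franel_g (p - 1 - j) - franel_g (p - 1) * franel_g j"
    using assms(1) _ _ _ assms(2)
    by (rule dvd_recurrence_reflection[where A = 10 and B = 3])
      (use franel_g_recurrence in \<open>auto simp: franel_g_def\<close>)
  then show ?thesis by simp
qed

section \<open>Row \<open>p - 1\<close> modulo \<open>p\<close>, and values at \<open>p - 1\<close>
  and \<open>p\<close> modulo the square of \<open>p\<close>\<close>

lemma dvd_choose_prime_minus_one:
  assumes "prime p" "k < p"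
  shows "int p dvd int ((p - 1) choose k) - (-1) ^ k"
  using assms(2)
proof (induction k)
  case (Suc k)
  \<comment> \<open>Neighbours in row \<open>p - 1\<close> add up to an inner entry of row
    \<open>p\<close>, which is divisible by \<open>p\<close>; hence the signs alternate.\<close>
  have "p choose Suc k = ((p - 1) choose k) + ((p - 1) choose Suc k)"
    using choose_reduce_nat[of p "Suc k"] Suc.prems by simp
  moreover have "p dvd p choose Suc k"
    using dvd_choose_prime[of "Suc k" p] Suc.prems assms(1) by simp
  then have "int p dvd int (p choose Suc k)" by simp
  ultimately have "int p dvd int ((p - 1) choose k) + int ((p - 1) choose Suc k)"
    by simp
  moreover have "int p dvd int ((p - 1) choose k) - (-1) ^ k"
    using Suc by simp
  ultimately have "int p dvd (int ((p - 1) choose k) + int ((p - 1) choose Suc k)) - (int ((p - 1) choose k) - (-1) ^ k)"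
    by (rule dvd_diff)
  then show ?case by simp
qed simp

text \<open>The square minus its tangent line at \<open>s\<close> is \<open>(x - s)^2\<close>, so
  knowing \<open>x\<close> modulo \<open>m\<close> fixes the error modulo
  \<open>m^2\<close>.\<close>

lemma square_dvd_square_linearization:
  fixes x s m :: int
  assumes "m dvd x - s" "s^2 = 1"
  shows "m^2 dvd x^2 - (2 * s * x - 1)"
proof -
  have "x^2 - (2 * s * x - 1) = (x - s)^2"
    using assms(2) by (simp add: power2_diff mult_ac)
  then show ?thesis using assms(1) by (simp add: dvd_power_same)
qed

text \<open>The tangent line at \<open>s\<close> again; the cofactor of the double root is
  \<open>x + 2 * s\<close>.\<close>

lemma square_dvd_cube_linearization:
  fixes x s m :: int
  assumes "m dvd x - s" "s^2 = 1"
  shows "m^2 dvd x^3 - (3 * x - 2 * s)"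
proof -
  have "(x - s)^2 * (x + 2 * s) = x^3 - (3 * s^2 * x - 2 * s^2 * s)"
    by (simp add: algebra_simps power2_eq_square power3_eq_cube)
  then have "x^3 - (3 * x - 2 * s) = (x - s)^2 * (x + 2 * s)" using assms(2) by simp
  then show ?thesis using assms(1) by (simp add: dvd_power_same)
qed

lemma fermat_dvd:
  assumes "prime p" "\<not> p dvd b"
  shows "int p dvd int b ^ (p - 1) - 1"
  using fermat_theorem[OF assms] by (metis cong_iff_dvd_diff cong_int_iff of_nat_1 of_nat_power)

lemma sum_alternating_even: "(\<Sum>k\<le>2 * h. (-1) ^ k) = (1::int)"
  by (induction h) auto

lemma franel_prime_minus_one:
  assumes "prime p" "odd p"
  shows "[franel (p - 1) = 8 ^ (p - 1)] (mod int p ^ 2)"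
proof -
  obtain h where h: "p - 1 = 2 * h" using assms(2) by (auto elim: oddE)
  have "[franel (p - 1) = (\<Sum>k\<le>p - 1. 3 * int ((p - 1) choose k) - 2 * (-1) ^ k)] (mod int p ^ 2)"
    unfolding franel_def
  proof (intro cong_sum)
    fix k assume "k \<in> {..p - 1}"
    then have "k < p" using prime_gt_0_nat[OF assms(1)] by (auto intro: le_less_trans)
    then show "[int (p - 1 choose k) ^ 3 = 3 * int (p - 1 choose k) - 2 * (- 1) ^ k] (mod (int p)\<^sup>2)"
      unfolding cong_iff_dvd_diff
      by (intro square_dvd_cube_linearization dvd_choose_prime_minus_one assms)
        (auto simp flip: power_mult)
  qed
  also have "(\<Sum>k\<le>p - 1. 3 * int ((p - 1) choose k) - 2 * (-1) ^ k) = 3 * int (\<Sum>k\<le>p - 1. (p - 1) choose k) - 2 * (\<Sum>k\<le>p - 1. (-1) ^ k)"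
    by (simp add: sum_subtractf sum_distrib_left)
  also have "\<dots> = 3 * 2 ^ (p - 1) - 2 * 1"
    unfolding choose_row_sum h sum_alternating_even by simp
  \<comment> \<open>The cube linearization read backwards, at \<open>2 ^ (p - 1)\<close>, which is 1
    modulo \<open>p\<close> by Fermat.\<close>
  also have "[\<dots> = (2 ^ (p - 1)) ^ 3] (mod int p ^ 2)"
  proof -
    have "\<not> p dvd 2" using assms primes_dvd_imp_eq[of p 2] by auto
    then have "int p dvd 2 ^ (p - 1) - 1" using fermat_dvd[of p 2] assms(1) by simp
    then show ?thesis
      using square_dvd_cube_linearization[of "int p" "2 ^ (p - 1)" 1]
      by (subst cong_sym_eq) (simp add: cong_iff_dvd_diff)
  qed
  also have "(2 ^ (p - 1)) ^ 3 = (8::int) ^ (p - 1)"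
    by (simp flip: power_mult add: mult.commute) (simp add: power_mult)
  finally show ?thesis .
qed

lemma square_dvd_choose_prime_square:
  assumes "prime p" "0 < k" "k < p"
  shows "int p ^ 2 dvd int (p choose k) ^ 2"
  using dvd_choose_prime[of k p] assms by (intro dvd_power_same) simp

text \<open>In Vandermonde's convolution only the two outer terms survive.\<close>

lemma choose_double_prime:
  assumes "prime p" "0 < j" "j \<le> p"
  shows "[int (2 * p choose j) = 2 * int (p choose j)] (mod int p ^ 2)"
proof -
  have "int (2 * p choose j) = int (\<Sum>k\<le>j. (p choose k) * (p choose (j - k)))"
    using vandermonde[of p p j] by (simp add: mult_2)
  also have "\<dots> = (\<Sum>k\<le>j. int (p choose k) * int (p choose (j - k)))" by simp
  also have "[\<dots> = (\<Sum>k\<le>j. if k = 0 \<or> k = j then int (p choose j) else 0)] (mod int p ^ 2)"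
  proof (intro cong_sum)
    fix k assume k: "k \<in> {..j}"
    show "[int (p choose k) * int (p choose (j - k)) = (if k = 0 \<or> k = j then int (p choose j) else 0)] (mod (int p)\<^sup>2)"
    proof (cases "k = 0 \<or> k = j")
      case False
      then have "int p dvd int (p choose k)" "int p dvd int (p choose (j - k))"
        using k assms dvd_choose_prime[of k p] dvd_choose_prime[of "j - k" p] by auto
      then have "int p ^ 2 dvd int (p choose k) * int (p choose (j - k))"
        by (simp add: power2_eq_square mult_dvd_mono)
      then show ?thesis using False by (simp add: cong_0_iff)
    qed auto
  qed
  also have "(\<Sum>k\<le>j. if k = 0 \<or> k = j then int (p choose j) else 0) = (\<Sum>k\<in>{0, j}. int (p choose j))"
    by (rule sum.mono_neutral_cong_right) auto
  also have "\<dots> = 2 * int (p choose j)" using assms by simp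
  finally show ?thesis .
qed

lemma sum_atMost_ends:
  fixes f :: "nat \<Rightarrow> 'a::comm_monoid_add"
  assumes "0 < n"
  shows "(\<Sum>k\<le>n. f k) = f 0 + f n + (\<Sum>k\<in>{0<..<n}. f k)"
proof -
  have "{..n} = insert 0 (insert n {0<..<n})" using assms by auto
  then show ?thesis using assms by (simp add: add_ac)
qed

lemma franel_prime:
  assumes "prime p"
  shows "[franel p = 2] (mod int p ^ 2)"
proof -
  have "[(\<Sum>k\<in>{0<..<p}. int (p choose k) ^ 3) = (\<Sum>k\<in>{0<..<p}. 0)] (mod int p ^ 2)"
    by (intro cong_sum)
      (use assms in \<open>auto simp: cong_0_iff intro!: dvd_trans[OF square_dvd_choose_prime_square le_imp_power_dvd]\<close>)
  then have "[2 + (\<Sum>k\<in>{0<..<p}. int (p choose k) ^ 3) = 2 + 0] (mod int p ^ 2)"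
    by (intro cong_add) simp_all
  then show ?thesis
    unfolding franel_def using prime_gt_0_nat[OF assms] by (simp add: sum_atMost_ends)
qed

text \<open>Inner terms carry a squared binomial coefficient divisible by \<open>p\<close>. The ends
  give 1 and \<open>2 * p choose p\<close>, and the latter is 2 by
  \<open>choose_double_prime\<close> at \<open>j = p\<close>.\<close>

lemma franel_g_prime:
  assumes "prime p"
  shows "[franel_g p = 3] (mod int p ^ 2)"
proof -
  have "[(\<Sum>k\<in>{0<..<p}. int (p choose k) ^ 2 * int (2 * k choose k)) = (\<Sum>k\<in>{0<..<p}. 0)] (mod int p ^ 2)"
    by (intro cong_sum) (use assms in \<open>auto simp: cong_0_iff intro!: dvd_mult2 square_dvd_choose_prime_square\<close>)
  moreover have "[int (2 * p choose p) = 2] (mod int p ^ 2)"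
    using choose_double_prime[of p p] assms prime_gt_0_nat by simp
  ultimately have "[1 + int (2 * p choose p) + (\<Sum>k\<in>{0<..<p}. int (p choose k) ^ 2 * int (2 * k choose k)) = 1 + 2 + 0] (mod int p ^ 2)"
    by (intro cong_add) simp_all
  then show ?thesis
    unfolding franel_g_def using prime_gt_0_nat[OF assms] by (simp add: sum_atMost_ends)
qed

section \<open>Sums of central binomial coefficients and cube roots of unity\<close>

text \<open>The nontrivial character modulo 3, equal to (w^m - w^(2m))/(w - w^2) for a primitive
  cube root of unity w.\<close>

definition chi3 :: "nat \<Rightarrow> int" where
  "chi3 m = (if m mod 3 = 0 then 0 else if m mod 3 = 1 then 1 else -1)"

text \<open>The sum of the \<open>m\<close>-th powers of the two primitive cube roots of unity.\<close>

definition trace3 :: "nat \<Rightarrow> int" where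
  "trace3 m = (if m mod 3 = 0 then 2 else -1)"

text \<open>The powers of a root of X^2 + X + 1 satisfy this recurrence. It allows the sums below to
  be evaluated within the integers.\<close>

lemma chi3_recurrence: "chi3 (m + 2) = - chi3 (m + 1) - chi3 m"
proof -
  consider "m mod 3 = 0" | "m mod 3 = 1" | "m mod 3 = 2" by linarith
  then show ?thesis
    by cases (simp_all add: chi3_def mod_Suc numeral_2_eq_2)
qed

lemma trace3_recurrence: "trace3 (m + 2) = - trace3 (m + 1) - trace3 m"
proof -
  consider "m mod 3 = 0" | "m mod 3 = 1" | "m mod 3 = 2" by linarith
  then show ?thesis
    by cases (simp_all add: trace3_def mod_Suc numeral_2_eq_2)
qed

text \<open>With the shift operator E the sum is (1 + E)^(n+1) applied to \<open>f\<close> at 0;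
  Pascal's rule splits off one factor 1 + E.\<close>

lemma sum_Suc_choose_mult:
  fixes f :: "nat \<Rightarrow> 'a::comm_ring_1"
  shows "(\<Sum>j\<le>Suc n. of_nat (Suc n choose j) * f j) = (\<Sum>j\<le>n. of_nat (n choose j) * (f j + f (Suc j)))"
proof -
  have "(\<Sum>j\<le>Suc n. of_nat (Suc n choose j) * f j)
      = f 0 + (\<Sum>j\<le>n. of_nat (n choose Suc j) * f (Suc j)) + (\<Sum>j\<le>n. of_nat (n choose j) * f (Suc j))"
    by (subst sum.atMost_Suc_shift) (simp add: sum.distrib algebra_simps)
  also have "f 0 + (\<Sum>j\<le>n. of_nat (n choose Suc j) * f (Suc j)) = (\<Sum>j\<le>Suc n. of_nat (n choose j) * f j)"
    by (subst sum.atMost_Suc_shift) simp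
  also have "\<dots> = (\<Sum>j\<le>n. of_nat (n choose j) * f j)"
    by (simp add: binomial_eq_0)
  finally show ?thesis by (simp add: distrib_left sum.distrib)
qed

text \<open>On solutions of the recurrence, 1 + E = -E^2, hence (1 + E)^n = (-1)^n E^(2n). The
  offset \<open>m\<close> carries the accumulated shift.\<close>

lemma sum_choose_chi3: "(\<Sum>j\<le>n. int (n choose j) * chi3 (j + m)) = (-1) ^ n * chi3 (m + 2 * n)"
proof (induction n arbitrary: m)
  case (Suc n)
  have "(\<Sum>j\<le>Suc n. int (Suc n choose j) * chi3 (j + m)) = (\<Sum>j\<le>n. int (n choose j) * (chi3 (j + m) + chi3 (Suc j + m)))"
    by (rule sum_Suc_choose_mult)
  also have "\<dots> = (\<Sum>j\<le>n. - (int (n choose j) * chi3 (j + (m + 2))))"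
  proof (intro sum.cong refl)
    fix j
    have "chi3 (j + (m + 2)) = - chi3 (Suc j + m) - chi3 (j + m)"
      using chi3_recurrence[of "j + m"] by (simp add: add_ac)
    then show "int (n choose j) * (chi3 (j + m) + chi3 (Suc j + m)) = - (int (n choose j) * chi3 (j + (m + 2)))"
      by (simp only:) (simp add: algebra_simps)
  qed
  also have "\<dots> = (-1) ^ Suc n * chi3 (m + 2 * Suc n)"
    by (simp only: sum_negf Suc.IH) (simp add: add_ac)
  finally show ?case .
qed simp

text \<open>On solutions of the recurrence, (1 - E)^2 = -3E, hence (1 - E)^(2h) = (-3)^h E^h; two
  Pascal steps make one induction step.\<close>

lemma sum_choose_alternating_trace3:
  "(\<Sum>j\<le>2 * h. int (2 * h choose j) * ((-1) ^ j * trace3 (j + m))) = (-3) ^ h * trace3 (m + h)"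
proof (induction h arbitrary: m)
  case (Suc h)
  have "(\<Sum>j\<le>2 * Suc h. int (2 * Suc h choose j) * ((-1) ^ j * trace3 (j + m)))
    = (\<Sum>j\<le>Suc (Suc (2 * h)). int (Suc (Suc (2 * h)) choose j) * ((-1) ^ j * trace3 (j + m)))"
    by (simp only: mult_Suc_right add_2_eq_Suc)
  also have "\<dots> = (\<Sum>j\<le>2 * h. int (2 * h choose j) * (-3 * ((-1) ^ j * trace3 (j + (m + 1)))))"
    unfolding sum_Suc_choose_mult
  proof (intro sum.cong refl arg_cong2[where f = "(*)"])
    fix j
    show "(-1) ^ j * trace3 (j + m) + (-1) ^ Suc j * trace3 (Suc j + m) +
      ((-1) ^ Suc j * trace3 (Suc j + m) + (-1) ^ Suc (Suc j) * trace3 (Suc (Suc j) + m)) = -3 * ((-1) ^ j * trace3 (j + (m + 1)))"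
    proof -
      have "trace3 (Suc (Suc j) + m) = - trace3 (Suc j + m) - trace3 (j + m)"
        using trace3_recurrence[of "j + m"] by simp
      then show ?thesis by (simp only:) (simp add: algebra_simps)
    qed
  qed
  also have "\<dots> = -3 * (\<Sum>j\<le>2 * h. int (2 * h choose j) * ((-1) ^ j * trace3 (j + (m + 1))))"
    by (simp add: sum_distrib_left mult_ac)
  also have "\<dots> = (-3) ^ Suc h * trace3 (m + Suc h)"
    unfolding Suc.IH by (simp add: add_ac)
  finally show ?case .
qed simp

text \<open>As \<open>chi3\<close> has generating function x/(1 + x + x^2), such a convolution is
  the coefficient of a power of x in (1 + x)^M x/(1 + x + x^2). Here one factor 1 + x is
  expanded.\<close>

lemma sum_chi3_Suc:
  "(\<Sum>j\<le>Suc n. chi3 (Suc n - j) * int (Suc M choose j))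
    = (\<Sum>j\<le>Suc n. chi3 (Suc n - j) * int (M choose j)) + (\<Sum>j\<le>n. chi3 (n - j) * int (M choose j))"
proof -
  have "(\<Sum>j\<le>Suc n. chi3 (Suc n - j) * int (Suc M choose j))
      = chi3 (Suc n) + (\<Sum>j\<le>n. chi3 (n - j) * int (M choose Suc j)) + (\<Sum>j\<le>n. chi3 (n - j) * int (M choose j))"
    by (subst sum.atMost_Suc_shift) (simp add: sum.distrib algebra_simps)
  also have "chi3 (Suc n) + (\<Sum>j\<le>n. chi3 (n - j) * int (M choose Suc j)) = (\<Sum>j\<le>Suc n. chi3 (Suc n - j) * int (M choose j))"
    by (subst sum.atMost_Suc_shift) simp
  finally show ?thesis .
qed

text \<open>Multiplication by 1 + x + x^2 removes the denominator of that generating function,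
  leaving a single binomial coefficient.\<close>

lemma sum_chi3_three_term:
  "(\<Sum>j\<le>n + 2. chi3 (n + 2 - j) * int (M choose j)) + (\<Sum>j\<le>n + 1. chi3 (n + 1 - j) * int (M choose j))
    + (\<Sum>j\<le>n. chi3 (n - j) * int (M choose j)) = int (M choose (n + 1))"
proof -
  have "(\<Sum>j\<le>n + 2. chi3 (n + 2 - j) * int (M choose j)) + (\<Sum>j\<le>n + 1. chi3 (n + 1 - j) * int (M choose j))
    + (\<Sum>j\<le>n. chi3 (n - j) * int (M choose j))
    = (\<Sum>j\<le>n. (chi3 (n + 2 - j) + chi3 (n + 1 - j) + chi3 (n - j)) * int (M choose j)) + int (M choose (n + 1))"
    by (simp add: sum.distrib algebra_simps chi3_def[of 0] chi3_def[of "Suc 0"])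
  also have "(\<Sum>j\<le>n. (chi3 (n + 2 - j) + chi3 (n + 1 - j) + chi3 (n - j)) * int (M choose j)) = (\<Sum>j\<le>n. 0)"
  proof (intro sum.cong refl)
    fix j assume "j \<in> {..n}"
    then have "n + 2 - j = (n - j) + 2" "n + 1 - j = (n - j) + 1" by auto
    then show "(chi3 (n + 2 - j) + chi3 (n + 1 - j) + chi3 (n - j)) * int (M choose j) = 0"
      using chi3_recurrence[of "n - j"] by simp
  qed
  finally show ?thesis by simp
qed

text \<open>Writing (1 + x)^2 as (1 + x + x^2) + x, the first part contributes the new central
  coefficient and the second reproduces the case \<open>n\<close>.\<close>

lemma sum_central_binomial_chi3:
  "(\<Sum>k<n. int (2 * k choose k)) = (\<Sum>j\<le>n. chi3 (n - j) * int (2 * n choose j))"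
proof (induction n)
  case 0
  then show ?case by (simp add: chi3_def)
next
  case (Suc n)
  show ?case
  proof (cases n)
    case 0
    then show ?thesis by (simp add: chi3_def)
  next
    case (Suc m)
    define B where "B M r = (\<Sum>j\<le>r. chi3 (r - j) * int (M choose j))" for M r
    have step: "B (Suc M) (Suc r) = B M (Suc r) + B M r" for M r
      unfolding B_def by (rule sum_chi3_Suc)
    have "B (2 * Suc n) (Suc n) = B (Suc (Suc (2 * n))) (Suc n)" by simp
    also have "\<dots> = B (2 * n) (m + 2) + B (2 * n) (m + 1) + B (2 * n) m + B (2 * n) n"
      unfolding Suc by (simp add: step)
    also have "\<dots> = int (2 * n choose n) + B (2 * n) n"
      using sum_chi3_three_term[of m "2 * n"] Suc by (simp add: B_def)
    finally show ?thesis using Suc.IH by (simp add: B_def)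
  qed
qed

text \<open>The inner part of row \<open>2 * p\<close> is twice that of row \<open>p\<close>. Row
  \<open>p\<close>, weighted by the character, sums to \<open>chi3 p\<close>; this is already its
  term at \<open>j = 0\<close>, and the term at \<open>j = p\<close> is 0, so the inner part
  vanishes.\<close>

lemma sum_central_binomial_prime:
  assumes "prime p" "p > 3"
  shows "[(\<Sum>k<p. int (2 * k choose k)) = chi3 p] (mod int p ^ 2)"
proof -
  have p0: "0 < p" using assms by simp
  have odd: "odd p" using assms prime_odd_nat by auto
  have "p mod 3 \<noteq> 0" using assms primes_dvd_imp_eq[of 3 p] by (auto simp: dvd_eq_mod_eq_0)
  then consider "p mod 3 = 1" | "p mod 3 = 2" by linarith
  then have chi2: "chi3 (2 * p) = - chi3 p"
    by cases (simp_all add: chi3_def mod_mult_right_eq[of 2 p 3, symmetric])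
  have "(\<Sum>j\<le>p. chi3 (p - j) * int (p choose j)) = (\<Sum>j\<le>p. int (p choose j) * chi3 (j + 0))"
    by (subst sum_rev_atMost[symmetric]) (auto intro!: sum.cong simp flip: binomial_symmetric)
  also have "\<dots> = (-1) ^ p * chi3 (0 + 2 * p)" by (rule sum_choose_chi3)
  also have "\<dots> = chi3 p" using chi2 odd by simp
  finally have inner: "(\<Sum>j\<in>{0<..<p}. chi3 (p - j) * int (p choose j)) = 0"
    using p0 by (simp add: sum_atMost_ends chi3_def[of 0])
  have "(\<Sum>k<p. int (2 * k choose k)) = chi3 p + (\<Sum>j\<in>{0<..<p}. chi3 (p - j) * int (2 * p choose j))"
    using p0 by (simp add: sum_central_binomial_chi3 sum_atMost_ends chi3_def[of 0])
  also have "[\<dots> = chi3 p + (\<Sum>j\<in>{0<..<p}. chi3 (p - j) * (2 * int (p choose j)))] (mod int p ^ 2)"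
    by (intro cong_add cong_refl cong_sum cong_mult choose_double_prime) (use assms in auto)
  also have "(\<Sum>j\<in>{0<..<p}. chi3 (p - j) * (2 * int (p choose j))) = 2 * (\<Sum>j\<in>{0<..<p}. chi3 (p - j) * int (p choose j))"
    by (simp add: sum_distrib_left mult_ac)
  finally show ?thesis by (simp add: inner)
qed

section \<open>Central trinomial coefficients through complex cube roots of unity\<close>

lemma cube_root_of_unity_simps:
  fixes w :: "'a::comm_ring_1"
  assumes "w^2 + w + 1 = 0"
  shows "w^2 = - 1 - w" "w * w^2 = 1" "(w^2)^2 + w^2 + 1 = 0"
proof -
  have "w^2 = (w^2 + w + 1) - 1 - w" by simp
  then show "w^2 = - 1 - w" by (simp only: assms) simp
  have "w * w^2 = (w - 1) * (w^2 + w + 1) + 1"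
    by (simp add: algebra_simps power2_eq_square)
  then show "w * w^2 = 1" by (simp only: assms) simp
  have "(w^2)^2 + w^2 + 1 = (w^2 - w + 1) * (w^2 + w + 1)"
    by (simp add: algebra_simps power2_eq_square)
  then show "(w^2)^2 + w^2 + 1 = 0" by (simp only: assms) simp
qed

text \<open>Both sides are the central coefficient of \<open>(1 + X + X^2)^n\<close>, written as \<open>((1 + X)^2 - X)^n\<close> on the
  left and as \<open>((1 - w X) (1 - w^2 X))^n\<close> on the right.\<close>

lemma sum_choose_central_cube_root:
  fixes w :: complex
  assumes w: "w^2 + w + 1 = 0" and n: "even n"
  shows "(\<Sum>k\<le>n. of_nat (n choose k) * (-1) ^ k * of_nat (2 * k choose k))
    = (\<Sum>i\<le>n. of_nat (n choose i) ^ 2 * w ^ (2 * n - i))"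
proof -
  note w2 = cube_root_of_unity_simps(1)[OF w] and w3 = cube_root_of_unity_simps(2)[OF w]
  have "coeff ([:1, 1, 1:: complex:] ^ n) n = coeff (([:1, 1:] ^ 2 + monom (-1) 1) ^ n) n"
    by (simp add: power2_eq_square monom_altdef)
  also have "coeff (([:1, 1 :: complex:] ^ 2 + monom (-1) 1) ^ n) n
      = (\<Sum>k\<le>n. of_nat (n choose k) * coeff (monom ((-1) ^ (n - k)) (n - k) * [:1, 1:] ^ (2 * k)) n)"
    unfolding binomial_ring coeff_sum
    by (intro sum.cong refl) (simp add: of_nat_poly monom_power mult_ac flip: power_mult)
  also have "\<dots> = (\<Sum>k\<le>n. of_nat (n choose k) * (-1) ^ k * of_nat (2 * k choose k))"
  proof (rule sum.cong[OF refl])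
    fix k assume "k \<in> {..n}"
    moreover from this have "(-1) ^ (n - k) = ((-1) ^ k :: complex)"
      using n by (cases "even k") simp_all
    ultimately show "of_nat (n choose k) * coeff (monom ((-1) ^ (n - k)) (n - k) * [:1, 1:] ^ (2 * k)) n
      = of_nat (n choose k) * (-1) ^ k * (of_nat (2 * k choose k) :: complex)"
      by (simp add: coeff_monom_mult coeff_linear_poly_power)
  qed
  finally have 1: "coeff ([:1, 1, 1:] ^ n) n = (\<Sum>k\<le>n. of_nat (n choose k) * (-1) ^ k * (of_nat (2 * k choose k) :: complex))" .
  have "[:1, - w:] * [:1, - (w^2):] = [:1, - (w^2) - w, w * w^2:]"
    by simp
  also have "\<dots> = [:1, 1, 1:]"
    by (simp only: w3) (simp add: w2)
  finally have "[:1, 1, 1:] = [:1, - w:] * [:1, - (w^2):]" by (rule sym)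
  then have "coeff ([:1, 1, 1:] ^ n) n = coeff ([:1, - w:] ^ n * [:1, - (w^2):] ^ n) n"
    by (simp only: power_mult_distrib)
  also have "\<dots> = (\<Sum>i\<le>n. of_nat (n choose i) ^ 2 * w ^ (2 * n - i))"
    unfolding coeff_mult
  proof (intro sum.cong refl)
    fix i assume "i \<in> {..n}"
    then have i: "i \<le> n" by simp
    have "(- w) ^ i * (- (w^2)) ^ (n - i) = (-1) ^ n * w ^ (i + 2 * (n - i))"
      using i by (simp add: power_minus[of w] power_minus[of "w^2"] power_add flip: power_mult)
        (simp flip: power_add)
    also have "i + 2 * (n - i) = 2 * n - i" using i by simp
    finally have "(- w) ^ i * (- (w^2)) ^ (n - i) = w ^ (2 * n - i)" using n by simp
    then show "coeff ([:1, - w:] ^ n) i * coeff ([:1, - (w^2):] ^ n) (n - i) = of_nat (n choose i) ^ 2 * w ^ (2 * n - i)"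
      using i binomial_symmetric[OF i] by (simp add: coeff_linear_poly_power power2_eq_square)
  qed
  finally show ?thesis using 1 by simp
qed

lemma cube_root_powers_sum:
  fixes w :: complex
  assumes w: "w^2 + w + 1 = 0"
  shows "w ^ m + (w^2) ^ m = of_int (trace3 m)"
proof (induction m rule: less_induct)
  case (less m)
  consider "m = 0" | "m = 1" | i where "m = i + 2"
    by (metis Suc_eq_plus1 add_2_eq_Suc' not0_implies_Suc One_nat_def)
  then show ?case
  proof cases
    case 1
    then show ?thesis by (simp add: trace3_def)
  next
    case 2
    then show ?thesis using w by (simp add: trace3_def add.commute add_eq_0_iff)
  next
    case (3 i)
    note w2 = cube_root_of_unity_simps(1)[OF w]
    note w4 = cube_root_of_unity_simps(1)[OF cube_root_of_unity_simps(3)[OF w]]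
    have "w ^ m + (w^2) ^ m = w ^ i * w^2 + (w^2) ^ i * (w^2)^2"
      unfolding 3 by (simp only: power_add)
    also have "\<dots> = w ^ i * (- 1 - w) + (w^2) ^ i * (- 1 - w^2)"
      by (simp only: w4) (simp only: w2)
    also have "\<dots> = - (w ^ (i + 1) + (w^2) ^ (i + 1)) - (w ^ i + (w^2) ^ i)"
      by (simp add: algebra_simps)
    also have "\<dots> = of_int (trace3 m)"
      using less.IH[of i] less.IH[of "i + 1"] 3 trace3_recurrence[of i] by simp
    finally show ?thesis .
  qed
qed

text \<open>Adding the identities for the two conjugate roots replaces the powers of
  \<open>w\<close> by integers.\<close>

lemma sum_choose_central_trace3:
  assumes n: "even n"
  shows "2 * (\<Sum>k\<le>n. int (n choose k) * (-1) ^ k * int (2 * k choose k))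
    = (\<Sum>i\<le>n. int (n choose i) ^ 2 * trace3 (i + n))"
proof -
  define w where "w = Complex (- 1 / 2) (sqrt 3 / 2)"
  have w: "w^2 + w + 1 = 0"
    by (simp add: w_def complex_eq_iff power2_eq_square)
  note w' = cube_root_of_unity_simps(3)[OF w]
  \<comment> \<open>The two arguments add up to a multiple of 3, and \<open>trace3\<close> takes
    equal values at opposite residues.\<close>
  have tr: "trace3 (2 * n - i) = trace3 (i + n)" if "i \<le> n" for i
  proof -
    have "(2 * n - i) + (i + n) = 3 * n" using that by simp
    then have "(2 * n - i) mod 3 = 0 \<longleftrightarrow> (i + n) mod 3 = 0"
      by (metis dvd_add_right_iff dvd_add_left_iff dvd_triv_left mod_0_imp_dvd mod_eq_0_iff_dvd)
    then show ?thesis by (simp add: trace3_def)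
  qed
  define T where "T = (\<Sum>k\<le>n. int (n choose k) * (-1) ^ k * int (2 * k choose k))"
  have T: "of_int T = (\<Sum>k\<le>n. of_nat (n choose k) * (-1) ^ k * (of_nat (2 * k choose k) :: complex))"
    by (simp add: T_def)
  have "of_int (2 * T) = (of_int T + of_int T :: complex)" by simp
  also have "\<dots> = (\<Sum>i\<le>n. of_nat (n choose i) ^ 2 * (w ^ (2 * n - i) + (w^2) ^ (2 * n - i)))"
    using sum_choose_central_cube_root[OF w n] sum_choose_central_cube_root[OF w' n]
    by (simp only: T distrib_left sum.distrib)
  also have "\<dots> = of_int (\<Sum>i\<le>n. int (n choose i) ^ 2 * trace3 (i + n))"
    by (simp add: cube_root_powers_sum[OF w] tr)
  finally show ?thesis by (simp only: of_int_eq_iff T_def)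
qed

text \<open>A full period sums to 0, so only the first one or two terms, starting at
  \<open>p - 1\<close>, remain.\<close>

lemma sum_trace3:
  assumes "p mod 3 \<noteq> 0"
  shows "(\<Sum>i<p. trace3 (i + (p - 1))) = 2 * chi3 p"
proof -
  have block: "(\<Sum>i<3 * q + r. trace3 (i + m)) = (\<Sum>i<r. trace3 (i + m))" for q r m
  proof (induction q)
    case (Suc q)
    have "(\<Sum>i<3 * Suc q + r. trace3 (i + m)) = (\<Sum>i<Suc (Suc (Suc (3 * q + r))). trace3 (i + m))"
      by (simp only: mult_Suc_right add.assoc add_numeral_left numeral_3_eq_3 add_Suc plus_nat.add_0)
    also have "\<dots> = (\<Sum>i<3 * q + r. trace3 (i + m))"
      using trace3_recurrence[of "3 * q + r + m"] by simp
    finally show ?case using Suc by simp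
  qed simp
  define q where "q = p div 3"
  have "p = 3 * q + 1 \<or> p = 3 * q + 2" using assms unfolding q_def by presburger
  then consider "p = 3 * q + 1" | "p = 3 * q + 2" by blast
  then show ?thesis
  proof cases
    case 1
    have "(\<Sum>i<p. trace3 (i + 3 * q)) = (\<Sum>i<1. trace3 (i + 3 * q))"
      unfolding 1 by (rule block)
    then show ?thesis using 1 by (simp add: trace3_def chi3_def)
  next
    case 2
    have "(\<Sum>i<p. trace3 (i + (3 * q + 1))) = (\<Sum>i<2. trace3 (i + (3 * q + 1)))"
      unfolding 2 by (rule block)
    then show ?thesis using 2 by (simp add: trace3_def chi3_def numeral_2_eq_2 mod_Suc)
  qed
qed

section \<open>The congruences\<close>

text \<open>Linearizing the squares gives \<open>2 * T - S\<close>. A second linearization, in the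
  cube-root expression for \<open>T\<close>, gives \<open>4 * y - 3 * chi3 p\<close>, the tangent
  line of \<open>chi3 p * y^4\<close> at \<open>chi3 p\<close>.\<close>

lemma franel_g_prime_minus_one:
  assumes "prime p" "p > 3"
  shows "[franel_g (p - 1) = chi3 p * 9 ^ (p - 1)] (mod int p ^ 2)"
proof -
  have odd: "odd p" using assms prime_odd_nat by auto
  have p3: "p mod 3 \<noteq> 0" using assms primes_dvd_imp_eq[of 3 p] by (auto simp: dvd_eq_mod_eq_0)
  obtain h where h: "p - 1 = 2 * h" using odd by (auto elim: oddE)
  have lt: "{..p - 1} = {..<p}" using assms by auto
  define y where "y = (-3 :: int) ^ h"
  define c where "c k = int ((p - 1) choose k)" for k
  define T where "T = (\<Sum>k<p. c k * (-1) ^ k * int (2 * k choose k))"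
  define S where "S = (\<Sum>k<p. int (2 * k choose k))"
  have c1: "int p dvd c k - (-1) ^ k" if "k < p" for k
    unfolding c_def using assms that by (intro dvd_choose_prime_minus_one)
  have c2: "[c k ^ 2 = 2 * (-1) ^ k * c k - 1] (mod int p ^ 2)" if "k < p" for k
    unfolding cong_iff_dvd_diff using c1[OF that]
    by (intro square_dvd_square_linearization) (auto simp flip: power_mult)
  \<comment> \<open>With offset \<open>2 * h\<close> the accumulated shift is \<open>3 * h\<close>,
    where \<open>trace3\<close> is 2.\<close>
  have alt: "(\<Sum>i<p. c i * ((-1) ^ i * trace3 (i + (p - 1)))) = 2 * y"
    unfolding c_def lt[symmetric] h sum_choose_alternating_trace3 by (simp add: y_def trace3_def)
  have tr: "(\<Sum>i<p. trace3 (i + (p - 1))) = 2 * chi3 p"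
    using p3 by (rule sum_trace3)
  have "2 * T = (\<Sum>i<p. c i ^ 2 * trace3 (i + (p - 1)))"
    unfolding T_def c_def lt[symmetric] by (rule sum_choose_central_trace3) (use odd in simp)
  also have "[\<dots> = (\<Sum>i<p. (2 * (-1) ^ i * c i - 1) * trace3 (i + (p - 1)))] (mod int p ^ 2)"
    by (rule cong_sum, rule cong_mult[OF c2 cong_refl]) simp
  also have "(\<Sum>i<p. (2 * (-1) ^ i * c i - 1) * trace3 (i + (p - 1)))
      = 2 * (\<Sum>i<p. c i * ((-1) ^ i * trace3 (i + (p - 1)))) - (\<Sum>i<p. trace3 (i + (p - 1)))"
    unfolding sum_distrib_left sum_subtractf[symmetric]
    by (rule sum.cong[OF refl]) (simp add: algebra_simps)
  also have "\<dots> = 4 * y - 2 * chi3 p" unfolding alt tr by simp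
  finally have T: "[2 * T = 4 * y - 2 * chi3 p] (mod int p ^ 2)" .
  have S: "[S = chi3 p] (mod int p ^ 2)"
    unfolding S_def using assms by (rule sum_central_binomial_prime)
  \<comment> \<open>Evaluating the sum of \<open>alt\<close> a second time, with each
    \<open>c i\<close> replaced by its sign modulo \<open>p\<close>, gives \<open>y\<close> modulo
    \<open>p\<close>; this is Euler's criterion for -3.\<close>
  have "[(\<Sum>i<p. c i * ((-1) ^ i * trace3 (i + (p - 1)))) = (\<Sum>i<p. (-1) ^ i * ((-1) ^ i * trace3 (i + (p - 1))))] (mod int p)"
    by (rule cong_sum, rule cong_mult[OF _ cong_refl]) (use c1 in \<open>simp add: cong_iff_dvd_diff\<close>)
  also have "(\<Sum>i<p. (-1) ^ i * ((-1) ^ i * trace3 (i + (p - 1)))) = 2 * chi3 p"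
    unfolding tr[symmetric]
    by (rule sum.cong[OF refl]) (simp only: mult.assoc[symmetric] power_mult_distrib[symmetric], simp)
  finally have "[2 * y = 2 * chi3 p] (mod int p)" unfolding alt .
  moreover have "coprime 2 (int p)" using odd by simp
  ultimately have "[y = chi3 p] (mod int p)" using cong_mult_lcancel by blast
  then have y: "int p dvd y - chi3 p" by (simp only: cong_iff_dvd_diff)
  have chi: "chi3 p ^ 2 = 1" using p3 by (auto simp: chi3_def)
  have "chi3 p * y^4 - (4 * y - 3 * chi3 p) = (y - chi3 p)^2 * (chi3 p * y^2 + 2 * y + 3 * chi3 p)"
  proof -
    have "(y - chi3 p)^2 * (chi3 p * y^2 + 2 * y + 3 * chi3 p)
      = chi3 p * y^4 - 4 * (chi3 p)^2 * y + 3 * chi3 p * (chi3 p)^2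
        + (2 * y^3 * (1 - (chi3 p)^2) + chi3 p * y^2 * ((chi3 p)^2 - 1))"
      by (simp add: algebra_simps power2_eq_square power3_eq_cube power4_eq_xxxx)
    then show ?thesis by (simp add: chi)
  qed
  then have y4: "[chi3 p * y^4 = 4 * y - 3 * chi3 p] (mod int p ^ 2)"
    using y by (simp add: cong_iff_dvd_diff dvd_power_same)
  have "franel_g (p - 1) = (\<Sum>k<p. c k ^ 2 * int (2 * k choose k))"
    unfolding franel_g_def c_def lt by (rule refl)
  also have "[\<dots> = (\<Sum>k<p. (2 * (-1) ^ k * c k - 1) * int (2 * k choose k))] (mod int p ^ 2)"
    by (rule cong_sum, rule cong_mult[OF c2 cong_refl]) simp
  also have "(\<Sum>k<p. (2 * (-1) ^ k * c k - 1) * int (2 * k choose k)) = 2 * T - S"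
    unfolding T_def S_def sum_distrib_left sum_subtractf[symmetric]
    by (rule sum.cong[OF refl]) (simp add: algebra_simps)
  also have "[\<dots> = (4 * y - 2 * chi3 p) - chi3 p] (mod int p ^ 2)"
    using T S by (rule cong_diff)
  also have "(4 * y - 2 * chi3 p) - chi3 p = 4 * y - 3 * chi3 p" by simp
  also have "[\<dots> = chi3 p * y^4] (mod int p ^ 2)" using y4 by (rule cong_sym)
  also have "y^4 = 9 ^ (p - 1)"
  proof -
    have "y ^ 4 = ((-3) ^ 4) ^ h" unfolding y_def by (simp only: power_mult [symmetric] mult.commute[of h 4])
    also have "\<dots> = (9 ^ 2) ^ h" by simp
    finally show ?thesis unfolding h by (simp only: power_mult)
  qed
  finally show ?thesis .
qed

text \<open>The weight makes the exponent of \<open>c\<close> equal to \<open>p - 1 - k\<close>,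
  independent of \<open>n\<close>, so the sum over \<open>n\<close> is the hockey-stick sum
  \<open>up\<close>.\<close>

lemma sum_binomial_transform_mult_power:
  assumes "0 < p"
  shows "(\<Sum>n<p. binomial_transform c a n * c ^ (p - 1 - n))
    = a (p - 1) + (\<Sum>j\<in>{0<..<p}. int (p choose j) * (c ^ j * a (p - 1 - j)))"
proof -
  have up: "(\<Sum>n<p. int (n choose k)) = int (p choose Suc k)" for k
  proof -
    have "{..<p} = {..p - 1}" "Suc (p - 1) = p" using assms by auto
    then show ?thesis using sum_choose_upper[of k "p - 1"] by (simp only: of_nat_sum[symmetric])
  qed
  have "(\<Sum>n<p. binomial_transform c a n * c ^ (p - 1 - n))
      = (\<Sum>n<p. \<Sum>k\<le>n. int (n choose k) * (c ^ (n - k) * c ^ (p - 1 - n)) * a k)"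
    by (simp add: binomial_transform_def sum_distrib_left sum_distrib_right mult_ac)
  also have "\<dots> = (\<Sum>n<p. \<Sum>k<p. int (n choose k) * (c ^ (p - 1 - k) * a k))"
  proof (rule sum.cong[OF refl])
    fix n assume n: "n \<in> {..<p}"
    have "(\<Sum>k\<le>n. int (n choose k) * (c ^ (n - k) * c ^ (p - 1 - n)) * a k)
      = (\<Sum>k\<le>n. int (n choose k) * (c ^ (p - 1 - k) * a k))"
    proof (rule sum.cong[OF refl])
      fix k assume "k \<in> {..n}"
      then have "n - k + (p - 1 - n) = p - 1 - k" using n by auto
      then show "int (n choose k) * (c ^ (n - k) * c ^ (p - 1 - n)) * a k = int (n choose k) * (c ^ (p - 1 - k) * a k)"
        by (simp only: power_add[symmetric] mult.assoc)
    qed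
    also have "\<dots> = (\<Sum>k<p. int (n choose k) * (c ^ (p - 1 - k) * a k))"
      by (rule sum.mono_neutral_left) (use n in \<open>auto simp: binomial_eq_0\<close>)
    finally show "(\<Sum>k\<le>n. int (n choose k) * (c ^ (n - k) * c ^ (p - 1 - n)) * a k)
      = (\<Sum>k<p. int (n choose k) * (c ^ (p - 1 - k) * a k))" .
  qed
  also have "\<dots> = (\<Sum>k<p. int (p choose Suc k) * (c ^ (p - 1 - k) * a k))"
    by (subst sum.swap) (simp only: sum_distrib_right[symmetric] up)
  \<comment> \<open>Substituting \<open>k = p - 1 - j\<close> turns \<open>p choose Suc k\<close>
    into \<open>p choose j\<close> and exposes the reflected index.\<close>
  also have "\<dots> = (\<Sum>j<p. int (p choose Suc (p - Suc j)) * (c ^ (p - 1 - (p - Suc j)) * a (p - Suc j)))"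
    by (rule sum.nat_diff_reindex[symmetric])
  also have "\<dots> = (\<Sum>j<p. int (p choose j) * (c ^ j * a (p - 1 - j)))"
  proof (intro sum.cong refl)
    fix j assume "j \<in> {..<p}"
    then have "Suc (p - Suc j) = p - j" "p - 1 - (p - Suc j) = j" "p - Suc j = p - 1 - j" "p choose (p - j) = p choose j"
      by (auto simp: binomial_symmetric[of j p])
    then show "int (p choose Suc (p - Suc j)) * (c ^ (p - 1 - (p - Suc j)) * a (p - Suc j))
      = int (p choose j) * (c ^ j * a (p - 1 - j))"
      by metis
  qed
  also have "\<dots> = (\<Sum>j\<in>insert 0 {0<..<p}. int (p choose j) * (c ^ j * a (p - 1 - j)))"
    using assms by (intro sum.cong refl) auto
  also have "\<dots> = a (p - 1) + (\<Sum>j\<in>{0<..<p}. int (p choose j) * (c ^ j * a (p - 1 - j)))"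
    by (subst sum.insert) simp_all
  finally show ?thesis .
qed

text \<open>The factor \<open>p\<close> of \<open>p choose j\<close> lifts the reflection from
  modulo \<open>p\<close> to modulo its square. The parameter is split into the reflection factor
  \<open>d\<close> and a remaining factor \<open>e\<close>, which is 1 or -1 in the
  applications.\<close>

lemma sum_choose_prime_reflection:
  assumes p: "prime p"
    and refl: "\<And>j. j < p \<Longrightarrow> int p dvd d ^ j * a (p - 1 - j) - t * a j"
    and sum: "[(\<Sum>j\<in>{0<..<p}. int (p choose j) * (e ^ j * a j)) = 0] (mod int p ^ 2)"
  shows "[(\<Sum>n<p. binomial_transform (e * d) a n * (e * d) ^ (p - 1 - n)) = a (p - 1)] (mod int p ^ 2)"
proof -
  have "[(\<Sum>j\<in>{0<..<p}. int (p choose j) * ((e * d) ^ j * a (p - 1 - j)))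
      = (\<Sum>j\<in>{0<..<p}. t * (int (p choose j) * (e ^ j * a j)))] (mod int p ^ 2)"
  proof (intro cong_sum)
    fix j assume "j \<in> {0<..<p}"
    then have "int p dvd int (p choose j)" "int p dvd d ^ j * a (p - 1 - j) - t * a j"
      using dvd_choose_prime[of j p] p refl by auto
    then have "int p ^ 2 dvd e ^ j * (int (p choose j) * (d ^ j * a (p - 1 - j) - t * a j))"
      by (simp add: power2_eq_square mult_dvd_mono)
    then show "[int (p choose j) * ((e * d) ^ j * a (p - 1 - j)) = t * (int (p choose j) * (e ^ j * a j))] (mod int p ^ 2)"
      by (simp add: cong_iff_dvd_diff power_mult_distrib algebra_simps)
  qed
  also have "(\<Sum>j\<in>{0<..<p}. t * (int (p choose j) * (e ^ j * a j))) = t * (\<Sum>j\<in>{0<..<p}. int (p choose j) * (e ^ j * a j))"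
    by (simp add: sum_distrib_left)
  also have "[\<dots> = t * 0] (mod int p ^ 2)"
    using sum by (intro cong_mult cong_refl)
  finally have "[a (p - 1) + (\<Sum>j\<in>{0<..<p}. int (p choose j) * ((e * d) ^ j * a (p - 1 - j))) = a (p - 1) + t * 0] (mod int p ^ 2)"
    by (intro cong_add cong_refl)
  then show ?thesis
    unfolding sum_binomial_transform_mult_power[OF prime_gt_0_nat[OF p]] by simp
qed

text \<open>The claim multiplied by \<open>(-8) ^ (p - 1)\<close>, so that it is a congruence of
  integers; the next lemma does this for -9.\<close>

lemma sum_Q_8:
  assumes "prime p" "p > 3"
  shows "[(\<Sum>n<p. Q n * (-8) ^ (p - 1 - n)) = (-8) ^ (p - 1)] (mod int p ^ 2)"
proof -
  have odd: "odd p" using assms prime_odd_nat by auto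
  have "franel_g p = 1 + franel p + (\<Sum>j\<in>{0<..<p}. int (p choose j) * franel j)"
    using assms(2) unfolding franel_g_eq_binomial_transform binomial_transform_def
    by (simp add: sum_atMost_ends) (simp add: franel_def)
  then have "(\<Sum>j\<in>{0<..<p}. int (p choose j) * (1 ^ j * franel j)) = franel_g p - (1 + franel p)" by simp
  also have "[\<dots> = 3 - (1 + 2)] (mod int p ^ 2)"
    using assms by (intro cong_diff cong_add cong_refl franel_g_prime franel_prime)
  finally have "[(\<Sum>n<p. binomial_transform (1 * (-8)) franel n * (1 * (-8)) ^ (p - 1 - n)) = franel (p - 1)] (mod int p ^ 2)"
    using assms(1) by (intro sum_choose_prime_reflection[where t = "franel (p - 1)"] franel_reflection) simp_all
  also have "[franel (p - 1) = 8 ^ (p - 1)] (mod int p ^ 2)"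
    using assms(1) odd by (rule franel_prime_minus_one)
  finally show ?thesis using odd by (simp add: Q_eq_binomial_transform_franel)
qed

lemma sum_Q_9:
  assumes "prime p" "p > 3"
  shows "[(\<Sum>n<p. Q n * (-9) ^ (p - 1 - n)) = chi3 p * (-9) ^ (p - 1)] (mod int p ^ 2)"
proof -
  have odd: "odd p" using assms prime_odd_nat by auto
  \<comment> \<open>As \<open>p\<close> is odd, \<open>(-1) ^ (p - k)\<close> is
    \<open>- ((-1) ^ k)\<close>, whence the sign of the left side.\<close>
  have "- franel p = (\<Sum>k\<le>p. int (p choose k) * ((-1) ^ k * franel_g k))"
    unfolding franel_eq_binomial_transform binomial_transform_def sum_negf[symmetric]
  proof (intro sum.cong refl)
    fix k assume "k \<in> {..p}"
    then show "- (int (p choose k) * (- 1) ^ (p - k) * franel_g k) = int (p choose k) * ((- 1) ^ k * franel_g k)"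
      using odd by (cases "even k") simp_all
  qed
  also have "\<dots> = 1 - franel_g p + (\<Sum>j\<in>{0<..<p}. int (p choose j) * ((-1) ^ j * franel_g j))"
    using assms(2) odd by (simp add: sum_atMost_ends) (simp add: franel_g_def)
  finally have "(\<Sum>j\<in>{0<..<p}. int (p choose j) * ((-1) ^ j * franel_g j)) = franel_g p - (1 + franel p)" by simp
  also have "[\<dots> = 3 - (1 + 2)] (mod int p ^ 2)"
    using assms by (intro cong_diff cong_add cong_refl franel_g_prime franel_prime)
  finally have "[(\<Sum>n<p. binomial_transform ((-1) * 9) franel_g n * ((-1) * 9) ^ (p - 1 - n)) = franel_g (p - 1)] (mod int p ^ 2)"
    using assms(1) by (intro sum_choose_prime_reflection[where t = "franel_g (p - 1)"] franel_g_reflection) simp_all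
  also have "[franel_g (p - 1) = chi3 p * 9 ^ (p - 1)] (mod int p ^ 2)"
    using assms by (rule franel_g_prime_minus_one)
  finally show ?thesis using odd by (simp add: Q_eq_binomial_transform_cgf)
qed

section \<open>The Legendre symbol and the passage to rational sums\<close>

lemma Legendre_3: "Legendre (int p) 3 = chi3 p"
proof -
  have "\<not> QuadRes 3 (int p)" if "p mod 3 = 2"
  proof
    assume "QuadRes 3 (int p)"
    then obtain y where "y^2 mod 3 = int p mod 3" by (auto simp: QuadRes_def cong_def)
    also have "int p mod 3 = 2" using that by (metis of_nat_mod of_nat_numeral)
    finally have "(y mod 3)^2 mod 3 = 2" by (simp add: power_mod)
    moreover have "y mod 3 = 0 \<or> y mod 3 = 1 \<or> y mod 3 = 2" by presburger
    ultimately show False by auto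
  qed
  moreover have "QuadRes 3 (int p)" if "p mod 3 = 1"
  proof -
    have "int p mod 3 = 1" using that by (metis of_nat_mod of_nat_numeral of_nat_1)
    then have "[1^2 = int p] (mod 3)" by (simp add: cong_def)
    then show ?thesis unfolding QuadRes_def by blast
  qed
  moreover have "p mod 3 = 0 \<or> p mod 3 = 1 \<or> p mod 3 = 2" by presburger
  moreover have "[int p = 0] (mod 3) \<longleftrightarrow> p mod 3 = 0"
    by (metis cong_0_iff dvd_eq_mod_eq_0 int_dvd_int_iff of_nat_numeral)
  ultimately show ?thesis by (auto simp: Legendre_def chi3_def)
qed

text \<open>The reduced denominator divides every other denominator of the same fraction, so it
  inherits coprimality to \<open>p\<close>.\<close>

lemma divide_in_local_ring:
  assumes "coprime b (int p)" "b \<noteq> 0"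
  shows "of_int a / of_int b \<in> local_ring p"
proof -
  obtain n d where nd: "quotient_of (of_int a / of_int b) = (n, d)" by fastforce
  have d: "d > 0" using nd by (rule quotient_of_denom_pos)
  have "of_int a / of_int b = (of_int n / of_int d :: rat)"
    using nd by (rule quotient_of_div)
  then have "of_int (a * d) = (of_int (n * b) :: rat)"
    using assms(2) d by (simp add: field_simps)
  then have "d dvd n * b" by (metis dvd_triv_right of_int_eq_iff)
  moreover have "coprime d n" using quotient_of_coprime[OF nd] by (simp add: coprime_commute)
  ultimately have "d dvd b" using coprime_dvd_mult_right_iff by blast
  then have "coprime d (int p)" using assms(1) coprime_divisors dvd_refl by blast
  then show ?thesis using nd by (simp add: local_ring_def)
qed

text \<open>The power \<open>c ^ (p - 1)\<close> is a unit of the local ring, so the integer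
  congruence may be divided by it.\<close>

lemma local_cong_sum_divide_power:
  assumes "coprime c (int p)" "c \<noteq> 0"
    and "[(\<Sum>n<p. a n * c ^ (p - 1 - n)) = t * c ^ (p - 1)] (mod int p ^ 2)"
  shows "local_cong p (of_nat p ^ 2) (\<Sum>n<p. of_int (a n) / of_int c ^ n) (of_int t)"
proof -
  define s where "s = (\<Sum>n<p. a n * c ^ (p - 1 - n))"
  have cp: "coprime (c ^ (p - 1)) (int p)" "c ^ (p - 1) \<noteq> 0" using assms by simp_all
  have "(\<Sum>n<p. of_int (a n) / of_int c ^ n) = (\<Sum>n<p. of_int (a n * c ^ (p - 1 - n)) / (of_int (c ^ (p - 1)) :: rat))"
  proof (intro sum.cong refl)
    fix n assume "n \<in> {..<p}"
    then have "p - 1 - n + n = p - 1" by auto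
    then have "c ^ (p - 1) = c ^ (p - 1 - n) * c ^ n" by (simp only: power_add[symmetric])
    then show "of_int (a n) / of_int c ^ n = of_int (a n * c ^ (p - 1 - n)) / (of_int (c ^ (p - 1)) :: rat)"
      using assms(2) by (simp only:) simp
  qed
  then have s: "(\<Sum>n<p. of_int (a n) / of_int c ^ n) = (of_int s / of_int (c ^ (p - 1)) :: rat)"
    by (simp add: s_def flip: sum_divide_distrib)
  obtain q where q: "s - t * c ^ (p - 1) = int p ^ 2 * q"
    using assms(3) unfolding s_def cong_iff_dvd_diff by (elim dvdE)
  have "of_int s / of_int (c ^ (p - 1)) - of_int t = (of_int (s - t * c ^ (p - 1)) / of_int (c ^ (p - 1)) :: rat)"
    using assms(2) by (simp add: diff_divide_distrib)
  also have "\<dots> = of_nat p ^ 2 * (of_int q / of_int (c ^ (p - 1)))"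
    unfolding q by simp
  finally show ?thesis
    unfolding local_cong_def s
    using divide_in_local_ring[OF cp] divide_in_local_ring[of 1 p t]
    by (intro conjI bexI[of _ "of_int q / of_int (c ^ (p - 1))"]) simp_all
qed

theorem theorem4p4:
  fixes p :: nat
  assumes "prime p" and "p > 3"
  shows "local_cong p (of_nat p ^ 2) (\<Sum>n=0..p-1. of_int (Q n) / (-8) ^ n) 1 \<and>
         local_cong p (of_nat p ^ 2) (\<Sum>n=0..p-1. of_int (Q n) / (-9) ^ n)
           (of_int (Legendre (int p) 3))"
proof -
  have lt: "{0..p - 1} = {..<p}" using assms(2) by auto
  have ndvd: "\<not> p dvd 2" "\<not> p dvd 3"
    using assms(2) by (auto dest: dvd_imp_le)
  \<comment> \<open>The shape matches -8 as \<open>- (2 ^ 3)\<close> and -9 as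
    \<open>- (3 ^ 2)\<close>.\<close>
  have cop: "coprime (- (int b ^ k)) (int p)" if "\<not> p dvd b" for b k
  proof -
    have "coprime p b" using assms(1) that by (rule prime_imp_coprime)
    then show ?thesis by (simp add: coprime_commute)
  qed
  have "local_cong p (of_nat p ^ 2) (\<Sum>n<p. of_int (Q n) / of_int (-8) ^ n) (of_int 1)"
    using cop[OF ndvd(1), of 3] sum_Q_8[OF assms] by (intro local_cong_sum_divide_power) simp_all
  moreover have "local_cong p (of_nat p ^ 2) (\<Sum>n<p. of_int (Q n) / of_int (-9) ^ n) (of_int (chi3 p))"
    using cop[OF ndvd(2), of 2] sum_Q_9[OF assms] by (intro local_cong_sum_divide_power) simp_all
  ultimately show ?thesis unfolding lt Legendre_3 by simp
qed

end
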